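(* Let $n\ge3$ and $1<d_1<d_2<\infty$. There exists a constant $C>0$ such that $$\int_0^\infty t^{\left(\frac{n-1}{2d_1}-\frac{n-1}{2d_2}\right)-\frac12}\|\mathcal{G}_1(\psi)(\cdot,0,t)\|_{L^{(d_2,1)}(\partial\mathbb{R}^n_+)}\,dt\le C\|\psi\|_{L^{(d_1,1)}(\partial\mathbb{R}^n_+)},$$ $$\int_0^\infty t^{\left(\frac{n-1}{2d_1}-\frac{n}{2d_2}\right)-\frac12}\|\mathcal{G}_1(\psi)(\cdot,t)\|_{L^{(d_2,1)}(\mathbb{R}^n_+)}\,dt\le C\|\psi\|_{L^{(d_1,1)}(\partial\mathbb{R}^n_+)},$$ $$\int_0^\infty t^{\left(\frac{n}{2d_1}-\frac{n-1}{2d_2}\right)-1}\|\mathcal{G}_2(\varphi)(\cdot,t)\|_{L^{(d_2,1)}(\partial\mathbb{R}^n_+)}\,dt\le C\|\varphi\|_{L^{(d_1,1)}(\mathbb{R}^n_+)},$$ for all $\psi\in L^{(d_1,1)}(\partial\mathbb{R}^n_+)$ and $\varphi\in L^{(d_1,1)}(\mathbb{R}^n_+)$.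
   Context: $\mathbb{R}^n_+=\{x=(x',x_n): x'\in\mathbb{R}^{n-1},\ x_n>0\}$; $\partial\mathbb{R}^n_+$ is identified with $\mathbb{R}^{n-1}$ with Lebesgue measure $dx'$, and $y'\in\partial\mathbb{R}^n_+$ with $(y',0)$. With $y^*=(y',-y_n)$ and $G(x,y,t)=(4\pi t)^{-n/2}\left[e^{-|x-y|^2/(4t)}+e^{-|x-y^*|^2/(4t)}\right]$ for $x,y\in\overline{\mathbb{R}^n_+}$, $t>0$, define $$\mathcal{G}_1(\psi)(x,t)=\int_{\partial\mathbb{R}^n_+}G(x,y',t)\psi(y')\,dy',\qquad \mathcal{G}_2(\varphi)(y',t)=\int_{\mathbb{R}^n_+}G(x,y',t)\varphi(x)\,dx,$$ for $x\in\overline{\mathbb{R}^n_+}$, $y'\in\partial\mathbb{R}^n_+$, $t>0$; $\mathcal{G}_1(\psi)(\cdot,0,t)$ denotes the restriction $x'\mapsto\mathcal{G}_1(\psi)((x',0),t)$. Lorentz spaces: for measurable $f$ on $\Omega$, $f^*(t)=\inf\{s>0:|\{x\in\Omega:|f(x)|>s\}|\le t\}$, $f^{**}(t)=\frac1t\int_0^tf^*(s)\,ds$; for $1<d<\infty$, $L^{(d,1)}(\Omega)$ is normed by $\|f\|_{L^{(d,1)}(\Omega)}=\int_0^\infty t^{1/d}f^{**}(t)\frac{dt}{t}$. *)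

theory Defs
  imports "HOL-Analysis.Analysis"
begin

text \<open>
  A point \<open>x = (x', x\<^sub>n)\<close> of \<open>\<real>\<^sup>n\<close> is a pair of type \<open>'a \<times> real\<close>, where the Euclidean space
  \<open>'a\<close> is \<open>\<real>\<^sup>n\<^sup>-\<^sup>1\<close>; thus \<open>n = DIM('a \<times> real) = DIM('a) + 1\<close>, and the norm and Lebesgue measure of
  the product type are the Euclidean ones. The boundary of the half-space is identified with
  \<open>'a\<close>, a boundary point \<open>y'\<close> being \<open>(y', 0)\<close>.
\<close>

definition half_space :: "('a::euclidean_space \<times> real) set" where
  "half_space = {x. snd x > 0}"

definition reflect :: "'a::euclidean_space \<times> real \<Rightarrow> 'a \<times> real" where
  "reflect y = (fst y, - snd y)"

definition neumann_kernel ::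
    "'a::euclidean_space \<times> real \<Rightarrow> 'a \<times> real \<Rightarrow> real \<Rightarrow> real" where
  "neumann_kernel x y t =
     (4 * pi * t) powr (- real DIM('a \<times> real) / 2) *
       (exp (- (norm (x - y))\<^sup>2 / (4 * t)) + exp (- (norm (x - reflect y))\<^sup>2 / (4 * t)))"

definition G1 :: "('a::euclidean_space \<Rightarrow> real) \<Rightarrow> 'a \<times> real \<Rightarrow> real \<Rightarrow> real" where
  "G1 \<psi> x t = (LINT y'|lebesgue. neumann_kernel x (y', 0) t * \<psi> y')"

definition G2 :: "('a::euclidean_space \<times> real \<Rightarrow> real) \<Rightarrow> 'a \<Rightarrow> real \<Rightarrow> real" where
  "G2 \<phi> y' t = (LINT x|lebesgue_on half_space. neumann_kernel x (y', 0) t * \<phi> x)"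

text \<open>
  Lorentz spaces over an arbitrary measure space \<open>M\<close>. All quantities are extended nonnegative
  reals; the infimum of the empty set is \<open>\<infinity>\<close>.
\<close>

definition decr_rearr :: "'b measure \<Rightarrow> ('b \<Rightarrow> real) \<Rightarrow> real \<Rightarrow> ennreal" where
  "decr_rearr M f t =
     (INF s\<in>{s::real. s > 0 \<and> emeasure M {x \<in> space M. \<bar>f x\<bar> > s} \<le> ennreal t}. ennreal s)"

definition max_rearr :: "'b measure \<Rightarrow> ('b \<Rightarrow> real) \<Rightarrow> real \<Rightarrow> ennreal" where
  "max_rearr M f t = ennreal (1 / t) * (\<integral>\<^sup>+s\<in>{0<..<t}. decr_rearr M f s \<partial>lborel)"

definition lorentz1_norm :: "'b measure \<Rightarrow> real \<Rightarrow> ('b \<Rightarrow> real) \<Rightarrow> ennreal" where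
  "lorentz1_norm M d f =
     (\<integral>\<^sup>+t\<in>{0<..}. ennreal (t powr (1 / d) * (1 / t)) * max_rearr M f t \<partial>lborel)"

definition lorentz1_space :: "'b measure \<Rightarrow> real \<Rightarrow> ('b \<Rightarrow> real) set" where
  "lorentz1_space M d = {f \<in> borel_measurable M. lorentz1_norm M d f < \<infinity>}"

end

theory Submission
  imports Defs "HOL-Probability.Distributions"
begin

text \<open>
  All three operators are positive kernel operators with row integrals at most \<open>c t\<^sup>-\<^sup>b\<close>, column
  integrals at most \<open>c t\<^sup>-\<^sup>a\<close> and kernel at most \<open>c t\<^sup>-\<^sup>e\<close>, where \<open>e = n / 2\<close>, \<open>c = 2\<close> and \<open>(a, b)\<close> is
  \<open>(1/2, 1/2)\<close>, \<open>(0, 1/2)\<close> and \<open>(1/2, 0)\<close> respectively. Cutting \<open>f\<close> into its level sets, with measures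
  \<open>\<mu> u\<close> of \<open>{\<bar>f\<bar> > u}\<close>, such an operator \<open>T\<close> with constants \<open>A\<close> (columns), \<open>B\<close> (rows) and \<open>D\<close> (kernel)
  satisfies \<open>(T f)\<^sup>*\<^sup>* s \<le> \<integral> min B (min D (A / s) * \<mu> u) du\<close>. On the other hand the \<open>(d, 1)\<close> norm of
  \<open>f\<close> is at least \<open>d \<integral> (\<mu> u) powr (1 / d) du\<close>. By Tonelli the claim reduces, for each single level \<open>u\<close>, to
  an explicit double integral of powers of \<open>s\<close> and \<open>t\<close>; the time weight is exactly the one for which it is
  homogeneous of degree \<open>1 / d1\<close> in \<open>\<mu> u\<close>.
\<close>

section \<open>Layer-cake formulas\<close>

text \<open>A value is the length of the interval of positive levels below it, which also covers
  \<open>top\<close>, since the half line has infinite length. Rewriting a value this way puts a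
  level variable under the integral, ready for Tonelli.\<close>

lemma emeasure_layer:
  fixes h :: ennreal
  shows "emeasure lborel {u. 0 < u \<and> ennreal u < h} = h"
proof (cases h)
  case (real r)
  have "{u. 0 < u \<and> ennreal u < h} = {0<..<r}"
    using real by (auto simp: ennreal_less_iff)
  then show ?thesis using real by simp
next
  case top
  have "{u. 0 < u \<and> ennreal u < h} = {0<..}"
    using top by auto
  moreover have "emeasure lborel {0::real<..} = \<infinity>"
  proof (rule ccontr)
    assume "emeasure lborel {0::real<..} \<noteq> \<infinity>"
    then obtain r where r: "emeasure lborel {0::real<..} = ennreal r" "r \<ge> 0"
      by (cases "emeasure lborel {0::real<..}") auto
    have "emeasure lborel {0<..<r+1} \<le> emeasure lborel {0::real<..}"
      by (rule emeasure_mono) auto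
    then show False using r by (simp add: ennreal_plus[symmetric] del: ennreal_plus)
  qed
  ultimately show ?thesis using top by simp
qed

text \<open>Tonelli on the region below the graph of \<open>g\<close>; sigma-finiteness of
  \<open>M\<close> allows the exchange.\<close>

lemma nn_integral_layer_cake:
  fixes g :: "'x \<Rightarrow> ennreal"
  assumes "sigma_finite_measure M" and [measurable]: "g \<in> borel_measurable M"
  shows "(\<integral>\<^sup>+x. g x \<partial>M) =
    (\<integral>\<^sup>+u\<in>{0<..}. emeasure M {x \<in> space M. ennreal u < g x} \<partial>lborel)"
proof -
  interpret M: sigma_finite_measure M by fact
  interpret pair_sigma_finite lborel M ..
  have "(\<integral>\<^sup>+x. g x \<partial>M) = (\<integral>\<^sup>+x. (\<integral>\<^sup>+u. indicator {u. 0 < u \<and> ennreal u < g x} u \<partial>lborel) \<partial>M)"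
    by (simp add: emeasure_layer)
  also have "\<dots> = (\<integral>\<^sup>+x. (\<integral>\<^sup>+u. (if 0 < u \<and> ennreal u < g x then 1 else 0) \<partial>lborel) \<partial>M)"
    by (intro nn_integral_cong) (auto simp: indicator_def)
  also have "\<dots> = (\<integral>\<^sup>+u. (\<integral>\<^sup>+x. (if 0 < u \<and> ennreal u < g x then 1 else 0) \<partial>M) \<partial>lborel)"
    by (rule Fubini') measurable
  also have "\<dots> = (\<integral>\<^sup>+u. (\<integral>\<^sup>+x. indicator {x \<in> space M. ennreal u < g x} x * indicator {0<..} u \<partial>M) \<partial>lborel)"
    by (intro nn_integral_cong) (auto simp: indicator_def)
  also have "\<dots> = (\<integral>\<^sup>+u\<in>{0<..}. emeasure M {x \<in> space M. ennreal u < g x} \<partial>lborel)"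
    by (simp add: nn_integral_multc)
  finally show ?thesis .
qed

text \<open>If \<open>m\<close> is a distribution function, the left integrand is the decreasing
  rearrangement at \<open>r\<close>, so this evaluates \<open>s * f^**(s)\<close>. After Tonelli,
  the \<open>r\<close> below both \<open>s\<close> and \<open>m u\<close> form an interval of length
  \<open>min s (m u)\<close>.\<close>

lemma nn_integral_layer_min:
  fixes m :: "real \<Rightarrow> ennreal"
  assumes [measurable]: "m \<in> borel_measurable borel"
  shows "(\<integral>\<^sup>+r\<in>{0<..<s}. emeasure lborel {u. 0 < u \<and> ennreal r < m u} \<partial>lborel) =
    (\<integral>\<^sup>+u\<in>{0<..}. min (ennreal s) (m u) \<partial>lborel)"
proof -
  have "(\<integral>\<^sup>+r\<in>{0<..<s}. emeasure lborel {u. 0 < u \<and> ennreal r < m u} \<partial>lborel) =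
     (\<integral>\<^sup>+r. (\<integral>\<^sup>+u. indicator {u. 0 < u \<and> ennreal r < m u} u * indicator {0<..<s} r \<partial>lborel) \<partial>lborel)"
    by (simp add: nn_integral_multc)
  also have "\<dots> = (\<integral>\<^sup>+r. (\<integral>\<^sup>+u. (if 0 < u \<and> ennreal r < m u \<and> 0 < r \<and> r < s then 1 else 0) \<partial>lborel) \<partial>lborel)"
    by (intro nn_integral_cong) (auto simp: indicator_def)
  also have "\<dots> = (\<integral>\<^sup>+u. (\<integral>\<^sup>+r. (if 0 < u \<and> ennreal r < m u \<and> 0 < r \<and> r < s then 1 else 0) \<partial>lborel) \<partial>lborel)"
    by (rule lborel_pair.Fubini') measurable
  also have "\<dots> = (\<integral>\<^sup>+u. (\<integral>\<^sup>+r. indicator {r. 0 < r \<and> ennreal r < min (ennreal s) (m u)} r * indicator {0<..} u \<partial>lborel) \<partial>lborel)"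
    by (intro nn_integral_cong) (auto simp: indicator_def ennreal_less_iff)
  also have "\<dots> = (\<integral>\<^sup>+u. emeasure lborel {r. 0 < r \<and> ennreal r < min (ennreal s) (m u)} * indicator {0<..} u \<partial>lborel)"
    by (simp add: nn_integral_multc)
  finally show ?thesis unfolding emeasure_layer .
qed

section \<open>Distribution functions, rearrangements and the Lorentz norm\<close>

definition distribution_fun :: "'b measure \<Rightarrow> ('b \<Rightarrow> real) \<Rightarrow> real \<Rightarrow> ennreal" where
  "distribution_fun M f u = emeasure M {x \<in> space M. \<bar>f x\<bar> > u}"

lemma measurable_distribution_fun:
  assumes "sigma_finite_measure M" and [measurable]: "f \<in> borel_measurable M"
  shows "distribution_fun M f \<in> borel_measurable borel"
proof -
  interpret M: sigma_finite_measure M by fact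
  show ?thesis unfolding distribution_fun_def by measurable
qed

text \<open>This is the upper bound of \<open>s * max_rearr M g s\<close> by a splitting into a
  bounded and an integrable part, as in the K-functional of L^1 and L^infinity. The constant
  survives the average over \<open>(0, s)\<close>, and the rearrangement of \<open>g1\<close>
  integrates to at most the integral of \<open>g1\<close>.\<close>

lemma max_rearr_le:
  assumes M: "sigma_finite_measure M" and g1[measurable]: "g1 \<in> borel_measurable M"
    and le: "\<And>x. x \<in> space M \<Longrightarrow> ennreal \<bar>g x\<bar> \<le> \<Lambda> + g1 x" and s: "s > 0"
  shows "max_rearr M g s \<le> \<Lambda> + (\<integral>\<^sup>+x. g1 x \<partial>M) / ennreal s"
proof (cases \<Lambda>)
  case (real l)
  interpret M: sigma_finite_measure M by fact
  define m where "m u = emeasure M {x \<in> space M. ennreal u < g1 x}" for u :: real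
  have m[measurable]: "m \<in> borel_measurable borel" unfolding m_def by measurable
  have *: "decr_rearr M g r \<le> \<Lambda> + emeasure lborel {u. 0 < u \<and> ennreal r < m u}" for r
  proof (cases "emeasure lborel {u. 0 < u \<and> ennreal r < m u}")
    case (real J)
    \<comment> \<open>The set of measure \<open>J\<close> cannot contain the longer interval
      \<open>(0, v)\<close>, so some \<open>u < v\<close> has \<open>m u\<close> at most
      \<open>r\<close>; then \<open>l + u\<close> is admissible in the infimum. As \<open>J\<close>
      itself may fail to be admissible, \<open>v\<close> tends to \<open>J\<close> at the
      end.\<close>
    have "decr_rearr M g r \<le> \<Lambda> + ennreal v" if v: "J < v" for v
    proof -
      have "\<exists>u. 0 < u \<and> u < v \<and> m u \<le> ennreal r"
      proof (rule ccontr)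
        assume "\<nexists>u. 0 < u \<and> u < v \<and> m u \<le> ennreal r"
        then have "{0<..<v} \<subseteq> {u. 0 < u \<and> ennreal r < m u}" by (auto simp: not_le)
        then have "emeasure lborel {0<..<v} \<le> emeasure lborel {u. 0 < u \<and> ennreal r < m u}"
          by (rule emeasure_mono) measurable
        then show False using real v by simp
      qed
      then obtain u where u: "0 < u" "u < v" "m u \<le> ennreal r" by blast
      have "{x \<in> space M. l + u < \<bar>g x\<bar>} \<subseteq> {x \<in> space M. ennreal u < g1 x}"
      proof safe
        fix x assume x: "x \<in> space M" "l + u < \<bar>g x\<bar>"
        then have "ennreal (l + u) < ennreal \<bar>g x\<bar>" using u \<open>0 \<le> l\<close> by (intro ennreal_lessI) auto
        also have "\<dots> \<le> ennreal l + g1 x" using le[OF x(1)] \<open>\<Lambda> = ennreal l\<close> by simp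
        finally show "ennreal u < g1 x" using u \<open>0 \<le> l\<close>
          by (simp add: ennreal_plus)
      qed
      then have "emeasure M {x \<in> space M. l + u < \<bar>g x\<bar>} \<le> m u"
        unfolding m_def by (rule emeasure_mono) measurable
      then have "decr_rearr M g r \<le> ennreal (l + u)"
        unfolding decr_rearr_def using u \<open>0 \<le> l\<close> by (intro INF_lower) auto
      also have "\<dots> \<le> \<Lambda> + ennreal v"
        using u \<open>0 \<le> l\<close> \<open>\<Lambda> = ennreal l\<close> by (simp add: ennreal_plus[symmetric] ennreal_leI del: ennreal_plus)
      finally show ?thesis .
    qed
    then have "decr_rearr M g r \<le> ennreal l + ennreal (J + e)" if "e > 0" for e
      using that \<open>\<Lambda> = ennreal l\<close> by simp
    then have "decr_rearr M g r \<le> (ennreal l + ennreal J) + ennreal e" if "e > 0" for e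
      using that \<open>0 \<le> J\<close> by (simp add: ennreal_plus add.assoc)
    then show ?thesis using real \<open>\<Lambda> = ennreal l\<close>
      by (metis ennreal_le_epsilon)
  qed simp
  have "max_rearr M g s \<le> ennreal (1 / s) *
      (\<integral>\<^sup>+r\<in>{0<..<s}. (\<Lambda> + emeasure lborel {u. 0 < u \<and> ennreal r < m u}) \<partial>lborel)"
    unfolding max_rearr_def by (intro mult_left_mono nn_integral_mono mult_right_mono *) auto
  also have "\<dots> = ennreal (1 / s) * (\<Lambda> * ennreal s +
      (\<integral>\<^sup>+r\<in>{0<..<s}. emeasure lborel {u. 0 < u \<and> ennreal r < m u} \<partial>lborel))"
    using s by (simp add: distrib_right nn_integral_add nn_integral_cmult)
  \<comment> \<open>Here \<open>min s (m u)\<close> is replaced by \<open>m u\<close>, whose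
    integral is that of \<open>g1\<close> by the layer cake.\<close>
  also have "\<dots> \<le> ennreal (1 / s) * (\<Lambda> * ennreal s + (\<integral>\<^sup>+x. g1 x \<partial>M))"
    unfolding nn_integral_layer_min[OF m] nn_integral_layer_cake[OF M g1] m_def[symmetric]
    by (intro mult_left_mono add_left_mono nn_integral_mono mult_right_mono) auto
  also have "\<dots> = \<Lambda> + (\<integral>\<^sup>+x. g1 x \<partial>M) / ennreal s"
  proof -
    have "ennreal (1 / s) * (\<Lambda> * ennreal s) = \<Lambda>"
      using s by (simp add: mult.left_commute[of _ \<Lambda>] ennreal_mult[symmetric])
    moreover have "ennreal (1 / s) * X = X / ennreal s" for X
      using s by (simp add: divide_ennreal_def inverse_ennreal mult.commute divide_inverse)
    ultimately show ?thesis by (simp add: distrib_left)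
  qed
  finally show ?thesis .
qed simp

text \<open>Distribution functions decrease, so every \<open>v\<close> admissible in the infimum
  lies above all \<open>u\<close> whose distribution function exceeds \<open>r\<close>.\<close>

lemma decr_rearr_ge:
  assumes [measurable]: "f \<in> borel_measurable M"
  shows "emeasure lborel {u. 0 < u \<and> ennreal r < distribution_fun M f u} \<le> decr_rearr M f r"
  unfolding decr_rearr_def
proof (rule INF_greatest, safe)
  fix v :: real assume v: "0 < v" "emeasure M {x \<in> space M. v < \<bar>f x\<bar>} \<le> ennreal r"
  have "u < v" if "ennreal r < distribution_fun M f u" for u
  proof (rule ccontr)
    assume "\<not> u < v"
    then have "distribution_fun M f u \<le> emeasure M {x \<in> space M. v < \<bar>f x\<bar>}"
      unfolding distribution_fun_def by (intro emeasure_mono) auto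
    with v that show False by (simp add: not_le[symmetric])
  qed
  then have "emeasure lborel {u. 0 < u \<and> ennreal r < distribution_fun M f u} \<le> emeasure lborel {0<..<v}"
    by (intro emeasure_mono) auto
  with v show "emeasure lborel {u. 0 < u \<and> ennreal r < distribution_fun M f u} \<le> ennreal v" by simp
qed

text \<open>This is the \<open>(d, 1)\<close> norm of the indicator of a set of measure
  \<open>m\<close>: for such a function the averaged rearrangement at \<open>t\<close> is
  \<open>min t m / t\<close>.\<close>

definition power_weight :: "real \<Rightarrow> ennreal \<Rightarrow> ennreal" where
  "power_weight d m = (\<integral>\<^sup>+t\<in>{0<..}. ennreal (t powr (1 / d) * (1 / t)) * (ennreal (1 / t) * min (ennreal t) m) \<partial>lborel)"

text \<open>The norm dominates the sum over all levels of the norms of the level set indicators.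
  This lower bound is what allows the right side of the final estimate to be treated one level at a
  time.\<close>

lemma lorentz1_norm_ge:
  assumes "sigma_finite_measure M" and f[measurable]: "f \<in> borel_measurable M"
  shows "(\<integral>\<^sup>+u\<in>{0<..}. power_weight d (distribution_fun M f u) \<partial>lborel) \<le> lorentz1_norm M d f"
proof -
  note m[measurable] = measurable_distribution_fun[OF assms]
  let ?w = "\<lambda>t. ennreal (t powr (1 / d) * (1 / t))"
  let ?m = "distribution_fun M f"
  have "(\<integral>\<^sup>+u\<in>{0<..}. power_weight d (?m u) \<partial>lborel) =
     (\<integral>\<^sup>+u. (\<integral>\<^sup>+t. ?w t * (ennreal (1 / t) * min (ennreal t) (?m u)) * indicator {0<..} t * indicator {0<..} u \<partial>lborel) \<partial>lborel)"
    unfolding power_weight_def by (intro nn_integral_cong) (simp add: nn_integral_multc)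
  also have "\<dots> = (\<integral>\<^sup>+t. (\<integral>\<^sup>+u. ?w t * (ennreal (1 / t) * min (ennreal t) (?m u)) * indicator {0<..} t * indicator {0<..} u \<partial>lborel) \<partial>lborel)"
    by (rule lborel_pair.Fubini') measurable
  also have "\<dots> = (\<integral>\<^sup>+t. (\<integral>\<^sup>+u. (?w t * ennreal (1 / t) * indicator {0<..} t) * (min (ennreal t) (?m u) * indicator {0<..} u) \<partial>lborel) \<partial>lborel)"
    by (intro nn_integral_cong) (simp add: mult_ac)
  also have "\<dots> = (\<integral>\<^sup>+t. ?w t * (ennreal (1 / t) * (\<integral>\<^sup>+u\<in>{0<..}. min (ennreal t) (?m u) \<partial>lborel)) * indicator {0<..} t \<partial>lborel)"
    by (intro nn_integral_cong, subst nn_integral_cmult) (auto simp: mult_ac)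
  also have "\<dots> \<le> lorentz1_norm M d f"
    unfolding lorentz1_norm_def max_rearr_def nn_integral_layer_min[OF m, symmetric]
    by (intro nn_integral_mono mult_right_mono mult_left_mono decr_rearr_ge f) auto
  finally show ?thesis .
qed

section \<open>Positive kernel operators and averaged rearrangements\<close>

text \<open>Slicing \<open>f\<close> into levels reduces it to indicators of its level sets. The
  image of one indicator is at most \<open>B\<close>, is at most \<open>D\<close> times the measure
  of the set, and has integral at most \<open>A\<close> times that measure. Levels handled by
  \<open>B\<close> enter the constant of \<open>max_rearr_le\<close>; the others enter that constant
  through \<open>D\<close> or the integrable part through \<open>A\<close>.\<close>

lemma max_rearr_kernel_le:
  fixes k :: "'x \<Rightarrow> 'y \<Rightarrow> real"
  assumes M: "sigma_finite_measure M" and N: "sigma_finite_measure N"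
    and k[measurable]: "case_prod k \<in> borel_measurable (M \<Otimes>\<^sub>M N)"
    and f[measurable]: "f \<in> borel_measurable N"
    and k0: "\<And>x y. x \<in> space M \<Longrightarrow> y \<in> space N \<Longrightarrow> 0 \<le> k x y"
    and D: "\<And>x y. x \<in> space M \<Longrightarrow> y \<in> space N \<Longrightarrow> k x y \<le> D"
    and A: "\<And>y. y \<in> space N \<Longrightarrow> (\<integral>\<^sup>+x. ennreal (k x y) \<partial>M) \<le> ennreal A"
    and B: "\<And>x. x \<in> space M \<Longrightarrow> (\<integral>\<^sup>+y. ennreal (k x y) \<partial>N) \<le> ennreal B"
    and s: "s > 0"
  shows "max_rearr M (\<lambda>x. LINT y|N. k x y * f y) s \<le>
    (\<integral>\<^sup>+u\<in>{0<..}. min (ennreal B) (ennreal (min D (A / s)) * distribution_fun N f u) \<partial>lborel)"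
proof -
  interpret M: sigma_finite_measure M by fact
  interpret N: sigma_finite_measure N by fact
  interpret LN: pair_sigma_finite lborel N ..
  interpret LM: pair_sigma_finite lborel M ..
  interpret MN: pair_sigma_finite M N ..
  let ?m = "distribution_fun N f"
  have m[measurable]: "?m \<in> borel_measurable borel"
    by (rule measurable_distribution_fun) fact+
  \<comment> \<open>Levels in \<open>U\<close> are estimated by the row bound, levels in \<open>V\<close> by the column bound or the sup bound.\<close>
  define R where "R = ennreal (min D (A / s))"
  define U where "U = {u. 0 < u \<and> ennreal B < R * ?m u}"
  define V where "V = {u. 0 < u \<and> \<not> ennreal B < R * ?m u}"
  have [measurable]: "U \<in> sets borel" "V \<in> sets borel" unfolding U_def V_def by measurable
  define h where "h u x = (\<integral>\<^sup>+y. ennreal (k x y) * (if u < \<bar>f y\<bar> then 1 else 0) \<partial>N)" for u x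
  have [measurable]: "(\<lambda>(u,x). h u x) \<in> borel_measurable (borel \<Otimes>\<^sub>M M)"
    unfolding h_def by measurable
  have [measurable]: "h u \<in> borel_measurable M" for u
    unfolding h_def by measurable
  define g1 where "g1 x = (\<integral>\<^sup>+u. h u x * indicator V u \<partial>lborel)" for x
  have [measurable]: "g1 \<in> borel_measurable M" unfolding g1_def by measurable
  define J where "J = (\<integral>\<^sup>+u. ?m u * indicator V u \<partial>lborel)"
  define \<Lambda> where "\<Lambda> = ennreal B * emeasure lborel U"
  have m_eq: "(\<integral>\<^sup>+y. (if u < \<bar>f y\<bar> then 1 else 0) \<partial>N) = ?m u" for u
  proof -
    have "(\<integral>\<^sup>+y. (if u < \<bar>f y\<bar> then 1 else 0) \<partial>N) = (\<integral>\<^sup>+y. indicator {y \<in> space N. u < \<bar>f y\<bar>} y \<partial>N)"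
      by (intro nn_integral_cong) auto
    then show ?thesis by (simp add: distribution_fun_def)
  qed
  have T: "ennreal \<bar>LINT y|N. k x y * f y\<bar> \<le> \<Lambda> + g1 x" if x: "x \<in> space M" for x
  proof -
    have [measurable]: "k x \<in> borel_measurable N" using k x by measurable
    have hB: "h u x \<le> ennreal B" for u
    proof -
      have "h u x \<le> (\<integral>\<^sup>+y. ennreal (k x y) \<partial>N)"
        unfolding h_def by (intro nn_integral_mono) auto
      with B[OF x] show ?thesis by simp
    qed
    \<comment> \<open>If the product is not integrable, \<open>LINT\<close> takes the default value
      0, so the bound holds in that case too.\<close>
    have "ennreal \<bar>LINT y|N. k x y * f y\<bar> \<le> (\<integral>\<^sup>+y. ennreal \<bar>k x y * f y\<bar> \<partial>N)"
      using integral_norm_bound_ennreal[of N "\<lambda>y. k x y * f y"] not_integrable_integral_eq[of N "\<lambda>y. k x y * f y"]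
      by (cases "integrable N (\<lambda>y. k x y * f y)") auto
    also have "\<dots> = (\<integral>\<^sup>+y. ennreal (k x y) * emeasure lborel {u. 0 < u \<and> ennreal u < ennreal \<bar>f y\<bar>} \<partial>N)"
      unfolding emeasure_layer using k0[OF x]
      by (intro nn_integral_cong) (simp add: abs_mult ennreal_mult)
    also have "\<dots> = (\<integral>\<^sup>+y. (\<integral>\<^sup>+u. ennreal (k x y) * indicator {u. 0 < u \<and> ennreal u < ennreal \<bar>f y\<bar>} u \<partial>lborel) \<partial>N)"
      by (simp add: nn_integral_cmult)
    also have "\<dots> = (\<integral>\<^sup>+y. (\<integral>\<^sup>+u. ennreal (k x y) * (if u < \<bar>f y\<bar> then 1 else 0) * indicator {0<..} u \<partial>lborel) \<partial>N)"
      by (intro nn_integral_cong) (auto simp: indicator_def ennreal_less_iff)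
    also have "\<dots> = (\<integral>\<^sup>+u. (\<integral>\<^sup>+y. ennreal (k x y) * (if u < \<bar>f y\<bar> then 1 else 0) * indicator {0<..} u \<partial>N) \<partial>lborel)"
      by (rule LN.Fubini') measurable
    also have "\<dots> = (\<integral>\<^sup>+u. h u x * indicator {0<..} u \<partial>lborel)"
      unfolding h_def by (simp add: nn_integral_multc)
    also have "\<dots> \<le> (\<integral>\<^sup>+u. ennreal B * indicator U u + h u x * indicator V u \<partial>lborel)"
      using hB by (intro nn_integral_mono) (auto simp: U_def V_def indicator_def)
    also have "\<dots> = \<Lambda> + g1 x"
      unfolding \<Lambda>_def g1_def using x by (subst nn_integral_add) (auto simp: nn_integral_cmult)
    finally show ?thesis .
  qed
  have "(\<integral>\<^sup>+x. g1 x \<partial>M) = (\<integral>\<^sup>+u. (\<integral>\<^sup>+x. h u x * indicator V u \<partial>M) \<partial>lborel)"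
    unfolding g1_def by (rule LM.Fubini') measurable
  also have "\<dots> \<le> (\<integral>\<^sup>+u. ennreal A * (?m u * indicator V u) \<partial>lborel)"
  proof (intro nn_integral_mono)
    fix u
    have "(\<integral>\<^sup>+x. h u x \<partial>M) = (\<integral>\<^sup>+y. (\<integral>\<^sup>+x. ennreal (k x y) * (if u < \<bar>f y\<bar> then 1 else 0) \<partial>M) \<partial>N)"
      unfolding h_def by (rule MN.Fubini'[symmetric]) measurable
    also have "\<dots> = (\<integral>\<^sup>+y. (\<integral>\<^sup>+x. ennreal (k x y) \<partial>M) * (if u < \<bar>f y\<bar> then 1 else 0) \<partial>N)"
      by (intro nn_integral_cong nn_integral_multc) measurable
    also have "\<dots> \<le> (\<integral>\<^sup>+y. ennreal A * (if u < \<bar>f y\<bar> then 1 else 0) \<partial>N)"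
      by (intro nn_integral_mono mult_right_mono A) auto
    also have "\<dots> = ennreal A * ?m u" by (simp add: nn_integral_cmult m_eq)
    finally show "(\<integral>\<^sup>+x. h u x * indicator V u \<partial>M) \<le> ennreal A * (?m u * indicator V u)"
      by (simp add: nn_integral_multc mult.assoc[symmetric] mult_right_mono)
  qed
  also have "\<dots> = ennreal A * J" unfolding J_def by (simp add: nn_integral_cmult)
  finally have g1A: "(\<integral>\<^sup>+x. g1 x \<partial>M) \<le> ennreal A * J" .
  have g1D: "g1 x \<le> ennreal D * J" if x: "x \<in> space M" for x
  proof -
    have "h u x \<le> ennreal D * ?m u" for u
    proof -
      have "h u x \<le> (\<integral>\<^sup>+y. ennreal D * (if u < \<bar>f y\<bar> then 1 else 0) \<partial>N)"
        unfolding h_def by (intro nn_integral_mono mult_right_mono ennreal_leI D x) auto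
      then show ?thesis by (simp add: nn_integral_cmult m_eq)
    qed
    then have "g1 x \<le> (\<integral>\<^sup>+u. ennreal D * (?m u * indicator V u) \<partial>lborel)"
      unfolding g1_def by (intro nn_integral_mono) (simp add: mult.assoc[symmetric] mult_right_mono)
    then show ?thesis unfolding J_def by (simp add: nn_integral_cmult)
  qed
  let ?T = "\<lambda>x. LINT y|N. k x y * f y"
  have "max_rearr M ?T s \<le> \<Lambda> + R * J"
  proof (cases "D \<le> A / s")
    \<comment> \<open>The sup bound is the better one: all of \<open>g1\<close> is absorbed into the
      constant and the integrable part is taken to be 0.\<close>
    case True
    have "max_rearr M ?T s \<le> (\<Lambda> + ennreal D * J) + (\<integral>\<^sup>+x. 0 \<partial>M) / ennreal s"
      by (intro max_rearr_le M s) (use order_trans[OF T add_left_mono[OF g1D]] in auto)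
    then show ?thesis using True by (simp add: R_def min_def)
  next
    case False
    have "max_rearr M ?T s \<le> \<Lambda> + (\<integral>\<^sup>+x. g1 x \<partial>M) / ennreal s"
      using T by (intro max_rearr_le M s) auto
    also have "\<dots> \<le> \<Lambda> + (ennreal A * J) / ennreal s"
      by (intro add_left_mono divide_right_mono_ennreal g1A)
    also have "(ennreal A * J) / ennreal s = R * J"
      using False s by (simp add: R_def min_def divide_ennreal_def inverse_ennreal divide_inverse ennreal_mult'' mult_ac)
    finally show ?thesis .
  qed
  \<comment> \<open>\<open>U\<close> and \<open>V\<close> were cut exactly where the two bounds
    cross, so the sum is pointwise the minimum.\<close>
  also have "\<Lambda> + R * J = (\<integral>\<^sup>+u. ennreal B * indicator U u + R * (?m u * indicator V u) \<partial>lborel)"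
    unfolding \<Lambda>_def J_def by (subst nn_integral_add) (auto simp: nn_integral_cmult)
  also have "\<dots> = (\<integral>\<^sup>+u\<in>{0<..}. min (ennreal B) (R * ?m u) \<partial>lborel)"
    by (intro nn_integral_cong) (auto simp: U_def V_def indicator_def min_def)
  finally show ?thesis unfolding R_def .
qed

section \<open>Power integrals for a single level\<close>

text \<open>The integrand is \<open>t powr (a - 1)\<close> below \<open>r\<close> and a multiple of
  \<open>t powr (a - 1 - q)\<close> above it. Positivity of \<open>a\<close> gives convergence at 0,
  and \<open>a < q\<close> gives it at infinity.\<close>

lemma nn_integral_power_split:
  fixes a q r :: real
  assumes a: "0 < a" and q: "a < q" and r: "r > 0"
  shows "(\<integral>\<^sup>+t\<in>{0<..}. ennreal (t powr (a - 1) * min 1 (r / t) powr q) \<partial>lborel)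
    = ennreal ((1 / a + 1 / (q - a)) * r powr a)"
proof -
  have "((\<lambda>x. x powr (a - 1)) has_integral (r powr a / a)) {0..r}"
    using has_integral_powr_from_0[of "a - 1" r] a r by simp
  then have 1: "(\<integral>\<^sup>+t. ennreal (indicator {0..r} t * t powr (a - 1)) \<partial>lborel) = ennreal (r powr a / a)"
    by (rule nn_integral_has_integral_lebesgue[rotated]) auto
  have "((\<lambda>x. r powr q * x powr (a - 1 - q)) has_integral (r powr q * (- (r powr (a - 1 - q + 1)) / (a - 1 - q + 1)))) {r..}"
    using q r by (intro has_integral_mult_right has_integral_powr_to_inf) auto
  moreover have "r powr q * (- (r powr (a - 1 - q + 1)) / (a - 1 - q + 1)) = r powr a / (q - a)"
    using r q by (simp add: powr_add[symmetric] field_simps)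
  ultimately have 2: "(\<integral>\<^sup>+t. ennreal (indicator {r..} t * (r powr q * t powr (a - 1 - q))) \<partial>lborel)
      = ennreal (r powr a / (q - a))"
    by (intro nn_integral_has_integral_lebesgue) auto
  have "(\<integral>\<^sup>+t\<in>{0<..}. ennreal (t powr (a - 1) * min 1 (r / t) powr q) \<partial>lborel) =
      (\<integral>\<^sup>+t. ennreal (indicator {0..r} t * t powr (a - 1)) +
        ennreal (indicator {r..} t * (r powr q * t powr (a - 1 - q))) \<partial>lborel)"
  proof (rule nn_integral_cong_AE)
    \<comment> \<open>The two closed ranges both count \<open>t = r\<close>; the endpoints form a
      null set.\<close>
    have "AE t in lborel. t \<noteq> 0 \<and> t \<noteq> r"
      using AE_lborel_singleton[of 0] AE_lborel_singleton[of r] by auto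
    then show "AE t in lborel. ennreal (t powr (a - 1) * min 1 (r / t) powr q) * indicator {0<..} t =
      ennreal (indicator {0..r} t * t powr (a - 1)) +
        ennreal (indicator {r..} t * (r powr q * t powr (a - 1 - q)))"
    proof eventually_elim
      case (elim t)
      consider "t < 0" | "0 < t" "t < r" | "r < t" using elim by linarith
      then show ?case
      proof cases
        case 3
        then have "t powr (a - 1) * min 1 (r / t) powr q = r powr q * t powr (a - 1 - q)"
          using r by (simp add: min_def powr_divide powr_diff)
        with 3 r show ?thesis by simp
      qed (use r in \<open>auto simp: min_def\<close>)
    qed
  qed
  also have "\<dots> = ennreal (r powr a / a) + ennreal (r powr a / (q - a))"
    by (subst nn_integral_add) (simp_all add: 1 2)
  also have "\<dots> = ennreal ((1 / a + 1 / (q - a)) * r powr a)"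
    using a q by (simp add: ennreal_plus[symmetric] field_simps del: ennreal_plus)
  finally show ?thesis .
qed

text \<open>On \<open>t \<le> m\<close> the minimum is \<open>t\<close> and the integrand is
  \<open>t powr (1 / d - 1)\<close>; the rest of the integral is discarded.\<close>

lemma power_weight_ge:
  assumes d: "1 < d" and m: "m > 0"
  shows "ennreal (d * m powr (1 / d)) \<le> power_weight d (ennreal m)"
proof -
  have "((\<lambda>x. x powr (1 / d - 1)) has_integral (m powr (1 / d) / (1 / d))) {0..m}"
    using has_integral_powr_from_0[of "1 / d - 1" m] d m by simp
  then have "(\<integral>\<^sup>+t. ennreal (indicator {0..m} t * t powr (1 / d - 1)) \<partial>lborel) = ennreal (m powr (1 / d) / (1 / d))"
    by (rule nn_integral_has_integral_lebesgue[rotated]) auto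
  then have "ennreal (d * m powr (1 / d)) = (\<integral>\<^sup>+t. ennreal (indicator {0..m} t * t powr (1 / d - 1)) \<partial>lborel)"
    by (simp add: mult.commute)
  also have "\<dots> \<le> power_weight d (ennreal m)"
    unfolding power_weight_def
  proof (rule nn_integral_mono_AE)
    have "AE t in lborel. t \<noteq> (0::real)" by (rule AE_lborel_singleton)
    then show "AE t in lborel. ennreal (indicator {0..m} t * t powr (1 / d - 1)) \<le>
      ennreal (t powr (1 / d) * (1 / t)) * (ennreal (1 / t) * min (ennreal t) (ennreal m)) * indicator {0<..} t"
    proof eventually_elim
      case (elim t)
      show ?case
      proof (cases "0 < t \<and> t \<le> m")
        case True
        then have "ennreal (1 / t) * min (ennreal t) (ennreal m) = 1"
          by (simp add: min_def ennreal_leI ennreal_mult[symmetric])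
        with True show ?thesis by (simp add: powr_diff)
      next
        case False
        with elim show ?thesis by (auto simp: indicator_def)
      qed
    qed
  qed
  finally show ?thesis .
qed

text \<open>The weight is monotone in \<open>m\<close>, and its lower bounds at finite
  \<open>m\<close> are unbounded.\<close>

lemma power_weight_top:
  assumes d: "1 < d"
  shows "power_weight d top = top"
proof (rule ccontr)
  assume "power_weight d top \<noteq> top"
  then obtain r where r: "power_weight d top = ennreal r" "0 \<le> r"
    by (cases "power_weight d top") auto
  \<comment> \<open>The measure \<open>(r + 1) powr d\<close> is chosen so that its root is
    \<open>r + 1\<close>, already larger than the supposed value \<open>r\<close>.\<close>
  have "ennreal (d * ((r + 1) powr d) powr (1 / d)) \<le> power_weight d (ennreal ((r + 1) powr d))"
    using d r by (intro power_weight_ge) auto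
  also have "\<dots> \<le> power_weight d top"
    unfolding power_weight_def by (intro nn_integral_mono mult_right_mono mult_left_mono min.mono) auto
  finally have "d * (r + 1) \<le> r" using r d by (simp add: powr_powr ennreal_le_iff)
  moreover have "1 * (r + 1) \<le> d * (r + 1)" using r d by (intro mult_right_mono) auto
  ultimately show False by simp
qed

text \<open>The minimum is the weighted geometric mean of itself with itself, and each factor is
  then enlarged separately.\<close>

lemma min_le_powr_mult:
  fixes x y \<theta> :: real
  assumes "0 \<le> x" "0 \<le> y" "0 \<le> \<theta>" "\<theta> \<le> 1"
  shows "min 1 (min x y) \<le> min 1 x powr \<theta> * min 1 y powr (1 - \<theta>)"
proof -
  have "min 1 (min x y) = min 1 (min x y) powr \<theta> * min 1 (min x y) powr (1 - \<theta>)"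
    using assms by (simp add: powr_add[symmetric])
  also have "\<dots> \<le> min 1 x powr \<theta> * min 1 y powr (1 - \<theta>)"
    using assms by (intro mult_mono powr_mono2) auto
  finally show ?thesis .
qed

text \<open>The integral over \<open>s\<close> yields \<open>Y powr \<beta>\<close>, a power of
  \<open>t\<close> times \<open>m powr \<beta>\<close>; the integral over \<open>t\<close> then
  yields \<open>r powr (p * \<delta>) = m powr \<delta>\<close>. The degrees add up to
  \<open>\<beta> + \<delta> = 1 / d1\<close>.\<close>

lemma kernel_weight_bound:
  fixes a b e d1 d2 :: real
  assumes d: "1 < d1" "d1 < d2" and be: "b < e"
  shows "\<exists>C\<ge>0. \<forall>m>0. (\<integral>\<^sup>+t\<in>{0<..}. (\<integral>\<^sup>+s\<in>{0<..}.
    ennreal (t powr ((e - b) / d1 - (e - a) / d2 + b - 1) * (s powr (1 / d2) * (1 / s)) *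
      min (t powr - b) (min (t powr - e) (t powr - a / s) * m)) \<partial>lborel) \<partial>lborel)
    \<le> ennreal (C * m powr (1 / d1))"
proof -
  \<comment> \<open>Any \<open>\<theta>\<close> with \<open>1/d1 - 1/d2 < \<theta> < 1 - 1/d2\<close> works: bounding the minimum by weighted powers separates the variables, and these
    two inequalities make the integrals over \<open>t\<close> and over \<open>s\<close> converge at infinity.\<close>
  define \<theta> where "\<theta> = (1 / d1 + 1) / 2 - 1 / d2"
  define \<beta> where "\<beta> = 1 / d2"
  define \<delta> where "\<delta> = 1 / d1 - 1 / d2"
  define p where "p = e - b"
  have inv: "1 / d2 < 1 / d1" "1 / d1 < 1" using d by (auto simp: field_simps)
  have \<beta>: "0 < \<beta>" "\<beta> < 1 - \<theta>" using inv d by (auto simp: \<beta>_def \<theta>_def)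
  have \<theta>: "0 < \<theta>" "\<theta> < 1" using inv \<beta> by (auto simp: \<theta>_def)
  have \<delta>: "0 < \<delta>" "\<delta> < \<theta>" using inv by (auto simp: \<delta>_def \<theta>_def)
  have p: "0 < p" using be by (simp add: p_def)
  \<comment> \<open>These are the constants of \<open>nn_integral_power_split\<close> for the
    exponent pairs \<open>(\<beta>, 1 - \<theta>)\<close> in \<open>s\<close> and
    \<open>(p * \<delta>, p * \<theta>)\<close> in \<open>t\<close>.\<close>
  define K1 where "K1 = 1 / \<beta> + 1 / (1 - \<theta> - \<beta>)"
  define K2 where "K2 = 1 / (p * \<delta>) + 1 / (p * \<theta> - p * \<delta>)"
  have K: "0 < K1" "0 < K2" using \<beta> \<theta> \<delta> p by (auto simp: K1_def K2_def intro!: add_pos_pos)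
  define w where "w = (e - b) / d1 - (e - a) / d2 + b - 1"
  \<comment> \<open>The choice of the time weight shows here: with \<open>t powr - b\<close>
    factored out and the power of \<open>t\<close> in \<open>Y powr \<beta>\<close> included,
    exactly the exponent \<open>p * \<delta> - 1\<close> remains.\<close>
  have w: "w - b + \<beta> * (b - a) = p * \<delta> - 1"
    using d by (simp add: w_def \<beta>_def p_def \<delta>_def field_simps)
  have "(\<integral>\<^sup>+t\<in>{0<..}. (\<integral>\<^sup>+s\<in>{0<..}.
      ennreal (t powr w * (s powr (1 / d2) * (1 / s)) *
      min (t powr - b) (min (t powr - e) (t powr - a / s) * m)) \<partial>lborel) \<partial>lborel)
    \<le> ennreal (K1 * K2 * m powr (1 / d1))" if m: "m > 0" for m
  proof -
    \<comment> \<open>\<open>r\<close> is the time at which the sup bound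
      \<open>t powr - e * m\<close> equals the row bound \<open>t powr - b\<close>.\<close>
    define r where "r = m powr (1 / p)"
    have r: "0 < r" using m by (simp add: r_def)
    have "(\<integral>\<^sup>+s\<in>{0<..}. ennreal (t powr w * (s powr (1 / d2) * (1 / s)) *
        min (t powr - b) (min (t powr - e) (t powr - a / s) * m)) \<partial>lborel)
      \<le> ennreal (K1 * m powr \<beta>) * ennreal (t powr (p * \<delta> - 1) * min 1 (r / t) powr (p * \<theta>))" (is "?L \<le> _")
      if t: "t > 0" for t
    proof -
      \<comment> \<open>\<open>X\<close> and \<open>Y / s\<close> are the ratios of the sup bound
        and of the column bound, each times \<open>m\<close>, to the row bound
        \<open>t powr - b\<close>.\<close>
      define X where "X = (r / t) powr p"
      define Y where "Y = t powr (b - a) * m"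
      have Y: "0 < Y" using t m by (simp add: Y_def)
      have X: "X = t powr (b - e) * m"
      proof -
        have "r powr p = m" using m p by (simp add: r_def powr_powr)
        moreover have "t powr (b - e) = 1 / t powr p" by (simp add: p_def powr_diff)
        ultimately show ?thesis using t r by (simp add: X_def powr_divide)
      qed
      have minX: "min 1 X powr \<theta> = min 1 (r / t) powr (p * \<theta>)"
      proof -
        have "min 1 X = min 1 (r / t) powr p"
        proof (cases "r / t \<le> 1")
          case True
          then have "X \<le> 1" using r t p powr_mono2[of p "r/t" 1] by (simp add: X_def)
          with True show ?thesis by (simp add: X_def min_def)
        next
          case False
          then have "X \<ge> 1" using p by (simp add: X_def ge_one_powr_ge_zero)
          with False show ?thesis by (auto simp: min_def)
        qed
        then show ?thesis by (simp add: powr_powr)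
      qed
      have "t powr w * (s powr (1 / d2) * (1 / s)) * min (t powr - b) (min (t powr - e) (t powr - a / s) * m)
        \<le> (t powr (w - b) * min 1 (r / t) powr (p * \<theta>)) * (s powr (\<beta> - 1) * min 1 (Y / s) powr (1 - \<theta>))"
        if s: "s > 0" for s
      proof -
        have "min (t powr - b) (min (t powr - e) (t powr - a / s) * m) =
            t powr - b * min 1 (min X (Y / s))"
        proof -
          have "t powr - b * X = t powr - e * m" "t powr - b * (Y / s) = t powr - a / s * m"
            using t unfolding X Y_def by (auto simp: powr_add[symmetric])
          moreover have "min (t powr - e) (t powr - a / s) * m = min (t powr - e * m) (t powr - a / s * m)"
            using m by (simp add: min_mult_distrib_right)
          moreover have "t powr - b * min 1 (min X (Y / s)) =
              min (t powr - b) (min (t powr - b * X) (t powr - b * (Y / s)))"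
            by (simp add: min_mult_distrib_left)
          ultimately show ?thesis by (simp only:)
        qed
        also have "\<dots> \<le> t powr - b * (min 1 X powr \<theta> * min 1 (Y / s) powr (1 - \<theta>))"
          using s Y \<theta> by (intro mult_left_mono min_le_powr_mult) (auto simp: X_def)
        finally have "t powr w * (s powr (1 / d2) * (1 / s)) * min (t powr - b) (min (t powr - e) (t powr - a / s) * m)
          \<le> t powr w * (s powr (1 / d2) * (1 / s)) * (t powr - b * (min 1 X powr \<theta> * min 1 (Y / s) powr (1 - \<theta>)))"
          using s by (intro mult_left_mono) auto
        also have "\<dots> = (t powr (w - b) * min 1 (r / t) powr (p * \<theta>)) * (s powr (\<beta> - 1) * min 1 (Y / s) powr (1 - \<theta>))"
          using s t by (simp add: minX \<beta>_def powr_diff powr_minus field_simps)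
        finally show ?thesis .
      qed
      then have "?L \<le> (\<integral>\<^sup>+s. ennreal (t powr (w - b) * min 1 (r / t) powr (p * \<theta>)) *
          (ennreal (s powr (\<beta> - 1) * min 1 (Y / s) powr (1 - \<theta>)) * indicator {0<..} s) \<partial>lborel)"
        by (intro nn_integral_mono) (auto simp: indicator_def ennreal_mult[symmetric] intro!: ennreal_leI)
      also have "\<dots> = ennreal (t powr (w - b) * min 1 (r / t) powr (p * \<theta>)) * ennreal (K1 * Y powr \<beta>)"
        using \<beta> Y by (simp add: nn_integral_cmult nn_integral_power_split K1_def)
      also have "\<dots> = ennreal (K1 * m powr \<beta>) * ennreal (t powr (p * \<delta> - 1) * min 1 (r / t) powr (p * \<theta>))"
      proof -
        have "t powr (p * \<delta> - 1) = t powr (w - b) * t powr (\<beta> * (b - a))"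
          unfolding w[symmetric] by (simp add: powr_add)
        then show ?thesis
          using K t m by (simp add: ennreal_mult[symmetric] Y_def powr_mult powr_powr mult_ac)
      qed
      finally show ?thesis .
    qed
    then have "(\<integral>\<^sup>+t\<in>{0<..}. (\<integral>\<^sup>+s\<in>{0<..}.
      ennreal (t powr w * (s powr (1 / d2) * (1 / s)) *
      min (t powr - b) (min (t powr - e) (t powr - a / s) * m)) \<partial>lborel) \<partial>lborel)
      \<le> (\<integral>\<^sup>+t. ennreal (K1 * m powr \<beta>) * (ennreal (t powr (p * \<delta> - 1) * min 1 (r / t) powr (p * \<theta>)) * indicator {0<..} t) \<partial>lborel)"
      by (intro nn_integral_mono) (auto simp: indicator_def)
    also have "\<dots> = ennreal (K1 * m powr \<beta>) * ennreal (K2 * r powr (p * \<delta>))"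
      using r p \<delta> by (simp add: nn_integral_cmult nn_integral_power_split K2_def)
    also have "\<dots> = ennreal (K1 * K2 * m powr (1 / d1))"
    proof -
      have "r powr (p * \<delta>) = m powr \<delta>" using p by (simp add: r_def powr_powr)
      moreover have "m powr (1 / d1) = m powr \<beta> * m powr \<delta>"
        by (simp add: \<beta>_def \<delta>_def powr_add[symmetric])
      ultimately show ?thesis using K by (simp add: ennreal_mult[symmetric] mult_ac)
    qed
    finally show ?thesis .
  qed
  then show ?thesis using K unfolding w_def by (intro exI[of _ "K1 * K2"]) auto
qed

section \<open>The time-weighted estimate for kernels with power bounds\<close>

text \<open>Common form of the three claims. For fixed \<open>t\<close> the averaged rearrangement
  is bounded level by level; after Tonelli, each level is compared with its own share of the
  \<open>d1\<close> norm, so the constant does not depend on \<open>f\<close>.\<close>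

lemma lorentz1_kernel_estimate:
  fixes k :: "real \<Rightarrow> 'x \<Rightarrow> 'y \<Rightarrow> real" and a b c e d1 d2 :: real
  assumes M: "sigma_finite_measure M" and N: "sigma_finite_measure N"
    and k: "\<And>t. t > 0 \<Longrightarrow> case_prod (k t) \<in> borel_measurable (M \<Otimes>\<^sub>M N)"
    and k0: "\<And>t x y. t > 0 \<Longrightarrow> x \<in> space M \<Longrightarrow> y \<in> space N \<Longrightarrow> 0 \<le> k t x y"
    and D: "\<And>t x y. t > 0 \<Longrightarrow> x \<in> space M \<Longrightarrow> y \<in> space N \<Longrightarrow> k t x y \<le> c * t powr - e"
    and A: "\<And>t y. t > 0 \<Longrightarrow> y \<in> space N \<Longrightarrow> (\<integral>\<^sup>+x. ennreal (k t x y) \<partial>M) \<le> ennreal (c * t powr - a)"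
    and B: "\<And>t x. t > 0 \<Longrightarrow> x \<in> space M \<Longrightarrow> (\<integral>\<^sup>+y. ennreal (k t x y) \<partial>N) \<le> ennreal (c * t powr - b)"
    and c: "0 \<le> c" and be: "b < e" and d: "1 < d1" "d1 < d2"
  shows "\<exists>C>0. \<forall>f \<in> borel_measurable N.
    (\<integral>\<^sup>+t\<in>{0<..}. ennreal (t powr ((e - b) / d1 - (e - a) / d2 + b - 1)) *
       lorentz1_norm M d2 (\<lambda>x. LINT y|N. k t x y * f y) \<partial>lborel)
    \<le> ennreal C * lorentz1_norm N d1 f"
proof -
  define w where "w = (e - b) / d1 - (e - a) / d2 + b - 1"
  obtain C0 where C0: "C0 \<ge> 0"
    and bound: "\<And>m. m > 0 \<Longrightarrow> (\<integral>\<^sup>+t\<in>{0<..}. (\<integral>\<^sup>+s\<in>{0<..}.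
    ennreal (t powr w * (s powr (1 / d2) * (1 / s)) *
      min (t powr - b) (min (t powr - e) (t powr - a / s) * m)) \<partial>lborel) \<partial>lborel)
    \<le> ennreal (C0 * m powr (1 / d1))"
    using kernel_weight_bound[OF d be, of a] unfolding w_def by auto
  \<comment> \<open>Dividing by \<open>d1\<close> uses up the factor in
    \<open>power_weight_ge\<close>; adding 1 keeps \<open>C\<close> positive.\<close>
  define C where "C = c * C0 / d1 + 1"
  have C: "C > 0" using c C0 d by (simp add: C_def add_nonneg_pos)
  \<comment> \<open>\<open>F t s m\<close> bounds the contribution of one level of measure
    \<open>m\<close>; \<open>m\<close> is extended real because level sets may have infinite
    measure.\<close>
  define F where "F t s m = ennreal (t powr w) * (ennreal (s powr (1 / d2) * (1 / s)) *
    min (ennreal (c * t powr - b)) (ennreal (min (c * t powr - e) (c * t powr - a / s)) * m))"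
    for t s :: real and m :: ennreal
  have F[measurable]: "(\<lambda>(t, s, m). F t s m) \<in> borel_measurable (borel \<Otimes>\<^sub>M borel \<Otimes>\<^sub>M borel)"
    unfolding F_def by measurable
  have [measurable]: "(\<lambda>(t, s). F t s m) \<in> borel_measurable (borel \<Otimes>\<^sub>M borel)" for m
    unfolding F_def by measurable
  have int_F: "(\<integral>\<^sup>+t\<in>{0<..}. (\<integral>\<^sup>+s\<in>{0<..}. F t s m \<partial>lborel) \<partial>lborel) \<le> ennreal C * power_weight d1 m" for m
  proof (cases m)
    case (real r)
    show ?thesis
    proof (cases "r = 0")
      case True
      then show ?thesis by (simp add: F_def real)
    next
      case False
      then have r: "r > 0" using real by simp
      have F_eq: "F t s m = ennreal c * ennreal (t powr w * (s powr (1 / d2) * (1 / s)) *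
        min (t powr - b) (min (t powr - e) (t powr - a / s) * r))" if "s > 0" for s t
      proof -
        have *: "min (c * t powr - e) (c * t powr - a / s) = c * min (t powr - e) (t powr - a / s)"
          using c by (simp add: min_mult_distrib_left)
        have "min (ennreal (c * t powr - b)) (ennreal (min (c * t powr - e) (c * t powr - a / s)) * m)
          = ennreal (min (c * t powr - b) (c * (min (t powr - e) (t powr - a / s) * r)))"
          using c r that unfolding real * by (simp add: ennreal_mult[symmetric] min_ennreal mult.assoc)
        also have "\<dots> = ennreal (c * min (t powr - b) (min (t powr - e) (t powr - a / s) * r))"
          using c by (simp add: min_mult_distrib_left)
        finally show ?thesis
          using c r that unfolding F_def by (simp add: ennreal_mult[symmetric] mult_ac)
      qed
      have "(\<integral>\<^sup>+t\<in>{0<..}. (\<integral>\<^sup>+s\<in>{0<..}. F t s m \<partial>lborel) \<partial>lborel)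
        = (\<integral>\<^sup>+t. (\<integral>\<^sup>+s. ennreal c * (ennreal (t powr w * (s powr (1 / d2) * (1 / s)) *
        min (t powr - b) (min (t powr - e) (t powr - a / s) * r)) * indicator {0<..} s) \<partial>lborel) * indicator {0<..} t \<partial>lborel)"
        by (rule nn_integral_cong, rule arg_cong2[of _ _ _ _ "(*)"], rule nn_integral_cong)
          (auto simp: indicator_def F_eq)
      also have "\<dots> = ennreal c * (\<integral>\<^sup>+t\<in>{0<..}. (\<integral>\<^sup>+s\<in>{0<..}. ennreal (t powr w * (s powr (1 / d2) * (1 / s)) *
        min (t powr - b) (min (t powr - e) (t powr - a / s) * r)) \<partial>lborel) \<partial>lborel)"
        by (simp add: nn_integral_cmult mult.assoc)
      also have "\<dots> \<le> ennreal c * ennreal (C0 * r powr (1 / d1))"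
        by (intro mult_left_mono bound r) auto
      also have "\<dots> \<le> ennreal C * ennreal (d1 * r powr (1 / d1))"
      proof -
        have "c * C0 \<le> C * d1" using d by (simp add: C_def field_simps)
        then have "c * C0 * r powr (1 / d1) \<le> C * d1 * r powr (1 / d1)" by (rule mult_right_mono) simp
        then show ?thesis using c C0 C d by (simp add: ennreal_mult[symmetric] mult_ac ennreal_leI)
      qed
      also have "\<dots> \<le> ennreal C * power_weight d1 m"
        unfolding real by (intro mult_left_mono power_weight_ge d r) auto
      finally show ?thesis .
    qed
  next
    \<comment> \<open>A level of infinite measure makes the right side infinite as well.\<close>
    case top
    then show ?thesis using C d by (simp add: power_weight_top ennreal_mult_top)
  qed
  have "(\<integral>\<^sup>+t\<in>{0<..}. ennreal (t powr w) * lorentz1_norm M d2 (\<lambda>x. LINT y|N. k t x y * f y) \<partial>lborel)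
      \<le> ennreal C * lorentz1_norm N d1 f"
    if f[measurable]: "f \<in> borel_measurable N" for f
  proof -
    let ?m = "distribution_fun N f"
    have m[measurable]: "?m \<in> borel_measurable borel"
      by (rule measurable_distribution_fun) fact+
    have "ennreal (t powr w) * lorentz1_norm M d2 (\<lambda>x. LINT y|N. k t x y * f y) \<le>
      (\<integral>\<^sup>+s\<in>{0<..}. (\<integral>\<^sup>+u\<in>{0<..}. F t s (?m u) \<partial>lborel) \<partial>lborel)" if t: "t > 0" for t
    proof -
      have "max_rearr M (\<lambda>x. LINT y|N. k t x y * f y) s \<le> (\<integral>\<^sup>+u\<in>{0<..}. min (ennreal (c * t powr - b))
          (ennreal (min (c * t powr - e) (c * t powr - a / s)) * ?m u) \<partial>lborel)" if "s > 0" for s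
        by (intro max_rearr_kernel_le M N k k0 D A B f t that)
      then have "lorentz1_norm M d2 (\<lambda>x. LINT y|N. k t x y * f y) \<le>
         (\<integral>\<^sup>+s\<in>{0<..}. ennreal (s powr (1 / d2) * (1 / s)) * (\<integral>\<^sup>+u\<in>{0<..}. min (ennreal (c * t powr - b))
          (ennreal (min (c * t powr - e) (c * t powr - a / s)) * ?m u) \<partial>lborel) \<partial>lborel)"
        unfolding lorentz1_norm_def
        by (intro nn_integral_mono) (auto simp: indicator_def intro!: mult_left_mono)
      then have "ennreal (t powr w) * lorentz1_norm M d2 (\<lambda>x. LINT y|N. k t x y * f y) \<le> ennreal (t powr w) *
         (\<integral>\<^sup>+s\<in>{0<..}. ennreal (s powr (1 / d2) * (1 / s)) * (\<integral>\<^sup>+u\<in>{0<..}. min (ennreal (c * t powr - b))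
          (ennreal (min (c * t powr - e) (c * t powr - a / s)) * ?m u) \<partial>lborel) \<partial>lborel)"
        by (rule mult_left_mono) simp
      also have "\<dots> = (\<integral>\<^sup>+s\<in>{0<..}. (\<integral>\<^sup>+u\<in>{0<..}. F t s (?m u) \<partial>lborel) \<partial>lborel)"
        unfolding F_def by (simp add: nn_integral_cmult mult.assoc)
      finally show ?thesis .
    qed
    then have "(\<integral>\<^sup>+t\<in>{0<..}. ennreal (t powr w) * lorentz1_norm M d2 (\<lambda>x. LINT y|N. k t x y * f y) \<partial>lborel)
      \<le> (\<integral>\<^sup>+t\<in>{0<..}. (\<integral>\<^sup>+s\<in>{0<..}. (\<integral>\<^sup>+u\<in>{0<..}. F t s (?m u) \<partial>lborel) \<partial>lborel) \<partial>lborel)"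
      by (intro nn_integral_mono) (auto simp: indicator_def)
    \<comment> \<open>To become the outermost variable, \<open>u\<close> is exchanged first with
      \<open>s\<close>, then with \<open>t\<close>; the indicators move inside so that each exchange
      concerns two adjacent integrals.\<close>
    also have "\<dots> = (\<integral>\<^sup>+t. (\<integral>\<^sup>+s. (\<integral>\<^sup>+u. F t s (?m u) * indicator {0<..} u * indicator {0<..} s \<partial>lborel) \<partial>lborel) * indicator {0<..} t \<partial>lborel)"
      by (simp add: nn_integral_multc)
    also have "\<dots> = (\<integral>\<^sup>+t. (\<integral>\<^sup>+u. (\<integral>\<^sup>+s. F t s (?m u) * indicator {0<..} u * indicator {0<..} s \<partial>lborel) \<partial>lborel) * indicator {0<..} t \<partial>lborel)"
      unfolding F_def
      by (intro nn_integral_cong arg_cong2[of _ _ _ _ "(*)"] lborel_pair.Fubini' refl) measurable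
    also have "\<dots> = (\<integral>\<^sup>+t. (\<integral>\<^sup>+u. (\<integral>\<^sup>+s. F t s (?m u) * indicator {0<..} u * indicator {0<..} s \<partial>lborel) * indicator {0<..} t \<partial>lborel) \<partial>lborel)"
      by (simp add: nn_integral_multc)
    also have "\<dots> = (\<integral>\<^sup>+u. (\<integral>\<^sup>+t. (\<integral>\<^sup>+s. F t s (?m u) * indicator {0<..} u * indicator {0<..} s \<partial>lborel) * indicator {0<..} t \<partial>lborel) \<partial>lborel)"
      unfolding F_def by (intro lborel_pair.Fubini') measurable
    also have "\<dots> = (\<integral>\<^sup>+u. (\<integral>\<^sup>+t. (\<integral>\<^sup>+s. (F t s (?m u) * indicator {0<..} s) * indicator {0<..} u \<partial>lborel) * indicator {0<..} t \<partial>lborel) \<partial>lborel)"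
      by (simp only: mult_ac)
    also have "\<dots> = (\<integral>\<^sup>+u. (\<integral>\<^sup>+t. ((\<integral>\<^sup>+s\<in>{0<..}. F t s (?m u) \<partial>lborel) * indicator {0<..} u) * indicator {0<..} t \<partial>lborel) \<partial>lborel)"
      by (simp add: nn_integral_multc)
    also have "\<dots> = (\<integral>\<^sup>+u. (\<integral>\<^sup>+t. ((\<integral>\<^sup>+s\<in>{0<..}. F t s (?m u) \<partial>lborel) * indicator {0<..} t) * indicator {0<..} u \<partial>lborel) \<partial>lborel)"
      by (simp only: mult_ac)
    also have "\<dots> = (\<integral>\<^sup>+u\<in>{0<..}. (\<integral>\<^sup>+t\<in>{0<..}. (\<integral>\<^sup>+s\<in>{0<..}. F t s (?m u) \<partial>lborel) \<partial>lborel) \<partial>lborel)"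
      by (simp add: nn_integral_multc)
    also have "\<dots> \<le> (\<integral>\<^sup>+u. ennreal C * (power_weight d1 (?m u) * indicator {0<..} u) \<partial>lborel)"
      by (intro nn_integral_mono) (auto simp: mult.assoc[symmetric] intro!: mult_right_mono int_F)
    also have "\<dots> = ennreal C * (\<integral>\<^sup>+u\<in>{0<..}. power_weight d1 (?m u) \<partial>lborel)"
      unfolding power_weight_def by (intro nn_integral_cmult) measurable
    also have "\<dots> \<le> ennreal C * lorentz1_norm N d1 f"
      by (intro mult_left_mono lorentz1_norm_ge N f) auto
    finally show ?thesis .
  qed
  then show ?thesis using C unfolding w_def by auto
qed

section \<open>Gaussian integrals\<close>

text \<open>The Gaussian factors over the coordinates, and each factor is a multiple of the normal
  density of variance \<open>2 * t\<close>.\<close>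

lemma nn_integral_gaussian:
  fixes y :: "'e::euclidean_space"
  assumes t: "t > 0"
  shows "(\<integral>\<^sup>+x. ennreal (exp (- (norm (x - y))\<^sup>2 / (4 * t))) \<partial>lborel)
    = ennreal ((4 * pi * t) powr (real DIM('e) / 2))"
proof -
  have 1: "(\<integral>\<^sup>+x. ennreal (exp (- (x - z)\<^sup>2 / (4 * t))) \<partial>lborel) = ennreal (sqrt (4 * pi * t))" for z :: real
  proof -
    have "(\<integral>\<^sup>+x. ennreal (normal_density z (sqrt (2 * t)) x) \<partial>lborel) = 1"
      using t by (subst nn_integral_eq_integral) auto
    moreover have "ennreal (exp (- (x - z)\<^sup>2 / (4 * t))) = ennreal (sqrt (4 * pi * t)) * ennreal (normal_density z (sqrt (2 * t)) x)" for x
      using t by (simp add: normal_density_def ennreal_mult[symmetric] mult_ac)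
    ultimately show ?thesis by (simp add: nn_integral_cmult)
  qed
  have "(\<integral>\<^sup>+x. ennreal (exp (- (norm (x - y))\<^sup>2 / (4 * t))) \<partial>lborel)
    = (\<integral>\<^sup>+x. (\<Prod>i\<in>Basis. ennreal (exp (- (x \<bullet> i - y \<bullet> i)\<^sup>2 / (4 * t)))) \<partial>lborel)"
  proof (intro nn_integral_cong)
    fix x
    have "(norm (x - y))\<^sup>2 = (\<Sum>i\<in>Basis. (x \<bullet> i - y \<bullet> i)\<^sup>2)"
      unfolding power2_norm_eq_inner euclidean_inner[of "x - y" "x - y"]
      by (simp add: inner_diff_left power2_eq_square)
    then have "exp (- (norm (x - y))\<^sup>2 / (4 * t)) = (\<Prod>i\<in>Basis. exp (- (x \<bullet> i - y \<bullet> i)\<^sup>2 / (4 * t)))"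
      by (simp add: exp_sum[symmetric] sum_negf sum_divide_distrib)
    then show "ennreal (exp (- (norm (x - y))\<^sup>2 / (4 * t))) = (\<Prod>i\<in>Basis. ennreal (exp (- (x \<bullet> i - y \<bullet> i)\<^sup>2 / (4 * t))))"
      by (simp add: prod_ennreal)
  qed
  also have "\<dots> = (\<Prod>i\<in>(Basis::'e set). (\<integral>\<^sup>+x. ennreal (exp (- (x - y \<bullet> i)\<^sup>2 / (4 * t))) \<partial>lborel))"
    by (rule nn_integral_lborel_prod) auto
  also have "\<dots> = ennreal (sqrt (4 * pi * t) ^ DIM('e))"
    unfolding 1 using t by (simp add: ennreal_power)
  also have "sqrt (4 * pi * t) ^ DIM('e) = (4 * pi * t) powr (real DIM('e) / 2)"
    using t by (simp add: powr_half_sqrt[symmetric] powr_powr powr_realpow[symmetric])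
  finally show ?thesis .
qed

section \<open>Lebesgue measure: sigma-finiteness and measurability\<close>

lemma sigma_finite_completion:
  assumes "sigma_finite_measure M"
  shows "sigma_finite_measure (completion M)"
proof -
  interpret sigma_finite_measure M by fact
  obtain C where C: "countable C" "C \<subseteq> sets M" "\<Union>C = space M" "\<forall>a\<in>C. emeasure M a \<noteq> \<infinity>"
    using sigma_finite_countable by blast
  then show ?thesis
    by (intro sigma_finite_measure.intro exI[of _ C])
      (auto simp: emeasure_completion subset_iff)
qed

lemma half_space_lebesgue: "half_space \<in> sets lebesgue"
proof -
  have "open (half_space :: ('a \<times> real) set)"
    unfolding half_space_def by (intro open_Collect_less continuous_intros)
  then show ?thesis by (auto intro: sets_completionI_sets)
qed

lemma sigma_finite_lebesgue: "sigma_finite_measure lebesgue"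
  by (intro sigma_finite_completion sigma_finite_lborel)

lemma sigma_finite_half_space: "sigma_finite_measure (lebesgue_on half_space)"
  by (intro sigma_finite_measure_restrict_space sigma_finite_lebesgue half_space_lebesgue)

lemma measurable_ident_lebesgue: "(\<lambda>x. x) \<in> borel_measurable lebesgue"
  by (rule measurable_completion) simp

lemma measurable_ident_half_space: "(\<lambda>x. x) \<in> borel_measurable (lebesgue_on half_space)"
  by (rule measurable_restrict_space1[OF measurable_ident_lebesgue])

text \<open>The kernels must be jointly measurable for a product of Lebesgue sigma-algebras. By
  second countability the Borel sets of the product space are the product Borel sets, so a
  continuous function factors through the two identity maps.\<close>

lemma borel_measurable_pair_continuous:
  fixes g :: "'p::second_countable_topology \<times> 'q::second_countable_topology \<Rightarrow> real"
  assumes "(\<lambda>x. x) \<in> borel_measurable M" "(\<lambda>x. x) \<in> borel_measurable N" "continuous_on UNIV g"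
  shows "g \<in> borel_measurable (M \<Otimes>\<^sub>M N)"
proof -
  have "(\<lambda>z. (fst z, snd z)) \<in> M \<Otimes>\<^sub>M N \<rightarrow>\<^sub>M borel \<Otimes>\<^sub>M borel"
    using assms by (intro measurable_Pair measurable_compose[OF measurable_fst] measurable_compose[OF measurable_snd])
  then have "(\<lambda>z. z) \<in> M \<Otimes>\<^sub>M N \<rightarrow>\<^sub>M borel" by (simp add: borel_prod)
  then show ?thesis
    using borel_measurable_continuous_onI[OF assms(3)] by (rule measurable_compose)
qed

section \<open>Bounds for the Neumann heat kernel\<close>

text \<open>A boundary point is its own reflection, so the two Gaussians coincide.\<close>

lemma neumann_kernel_boundary:
  fixes x :: "'a::euclidean_space \<times> real"
  shows "neumann_kernel x (y, 0) t =
    2 * (4 * pi * t) powr (- real DIM('a \<times> real) / 2) * exp (- (norm (x - (y, 0)))\<^sup>2 / (4 * t))"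
  by (simp add: neumann_kernel_def reflect_def)

lemma neumann_kernel_nonneg: "0 \<le> neumann_kernel x y t"
  by (simp add: neumann_kernel_def)

lemma powr_4pi_le:
  assumes "t > 0" "0 \<le> p"
  shows "(4 * pi * t) powr - p \<le> t powr - p"
proof (rule powr_mono2')
  have "1 * t \<le> 4 * pi * t" using assms pi_ge_two by (intro mult_right_mono) auto
  then show "t \<le> 4 * pi * t" by simp
qed (use assms in auto)

lemma neumann_kernel_le:
  fixes x :: "'a::euclidean_space \<times> real"
  assumes t: "t > 0"
  shows "neumann_kernel x (y, 0) t \<le> 2 * t powr - (real DIM('a \<times> real) / 2)"
proof -
  have "neumann_kernel x (y, 0) t \<le> 2 * (4 * pi * t) powr (- real DIM('a \<times> real) / 2)"
    unfolding neumann_kernel_boundary using t by (intro mult_left_le) auto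
  also have "\<dots> \<le> 2 * t powr - (real DIM('a \<times> real) / 2)"
    unfolding minus_divide_left[symmetric] by (intro mult_left_mono powr_4pi_le t) auto
  finally show ?thesis .
qed

text \<open>Dropping the normal component of \<open>x\<close> leaves a Gaussian in one dimension
  less, whose integral cancels all but the power \<open>-1/2\<close> of the prefactor.\<close>

lemma nn_integral_neumann_kernel_boundary:
  fixes x :: "'a::euclidean_space \<times> real"
  assumes t: "t > 0"
  shows "(\<integral>\<^sup>+y. ennreal (neumann_kernel x (y, 0) t) \<partial>lebesgue) \<le> ennreal (2 * t powr - (1 / 2))"
proof -
  let ?c = "2 * (4 * pi * t) powr (- real DIM('a \<times> real) / 2)"
  have "neumann_kernel x (y, 0) t \<le> ?c * exp (- (norm (y - fst x))\<^sup>2 / (4 * t))" for y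
  proof -
    have "norm (y - fst x) \<le> norm (x - (y, 0))"
      using norm_fst_le[of "fst x - y" "snd x"] by (cases x) (simp add: norm_minus_commute)
    then have "(norm (y - fst x))\<^sup>2 \<le> (norm (x - (y, 0)))\<^sup>2" by (rule power_mono) simp
    then show ?thesis unfolding neumann_kernel_boundary using t
      by (intro mult_left_mono) (auto simp: divide_right_mono)
  qed
  then have "(\<integral>\<^sup>+y. ennreal (neumann_kernel x (y, 0) t) \<partial>lebesgue) \<le>
      (\<integral>\<^sup>+y. ennreal ?c * ennreal (exp (- (norm (y - fst x))\<^sup>2 / (4 * t))) \<partial>lborel)"
    unfolding nn_integral_completion
    by (intro nn_integral_mono) (simp add: ennreal_mult[symmetric] ennreal_leI)
  also have "\<dots> = ennreal ?c * ennreal ((4 * pi * t) powr (real DIM('a) / 2))"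
    using nn_integral_gaussian[OF t, of "fst x"] by (simp add: nn_integral_cmult)
  also have "\<dots> = ennreal (2 * (4 * pi * t) powr - (1 / 2))"
  proof -
    have "- real DIM('a \<times> real) / 2 + real DIM('a) / 2 = - (1 / 2)" by (simp add: field_simps)
    then have "?c * (4 * pi * t) powr (real DIM('a) / 2) = 2 * (4 * pi * t) powr - (1 / 2)"
      by (simp only: powr_add[symmetric] mult.assoc)
    then show ?thesis by (simp only: ennreal_mult[symmetric] powr_ge_zero mult_nonneg_nonneg zero_le_numeral)
  qed
  also have "\<dots> \<le> ennreal (2 * t powr - (1 / 2))"
    using powr_4pi_le[OF t, of "1 / 2"] by (intro ennreal_leI) simp
  finally show ?thesis .
qed

text \<open>Enlarging the half-space to the whole space gives a full Gaussian, whose mass cancels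
  the prefactor up to the factor 2.\<close>

lemma nn_integral_neumann_kernel_half_space:
  fixes y :: "'a::euclidean_space"
  assumes t: "t > 0"
  shows "(\<integral>\<^sup>+x. ennreal (neumann_kernel x (y, 0) t) \<partial>lebesgue_on half_space) \<le> ennreal 2"
proof -
  let ?c = "2 * (4 * pi * t) powr (- real DIM('a \<times> real) / 2)"
  have "(\<integral>\<^sup>+x. ennreal (neumann_kernel x (y, 0) t) \<partial>lebesgue_on half_space)
      = (\<integral>\<^sup>+x\<in>half_space. ennreal (neumann_kernel x (y, 0) t) \<partial>lebesgue)"
    using half_space_lebesgue by (intro nn_integral_restrict_space) simp
  also have "\<dots> \<le> (\<integral>\<^sup>+x. ennreal (neumann_kernel x (y, 0) t) \<partial>lborel)"
    unfolding nn_integral_completion by (intro nn_integral_mono) (auto simp: indicator_def)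
  also have "\<dots> = (\<integral>\<^sup>+x. ennreal ?c * ennreal (exp (- (norm (x - (y, 0::real)))\<^sup>2 / (4 * t))) \<partial>lborel)"
    by (simp add: neumann_kernel_boundary ennreal_mult[symmetric])
  also have "\<dots> = ennreal ?c * ennreal ((4 * pi * t) powr (real DIM('a \<times> real) / 2))"
    using nn_integral_gaussian[OF t, of "(y, 0::real)"] by (simp add: nn_integral_cmult)
  also have "\<dots> = ennreal 2"
  proof -
    have "?c * (4 * pi * t) powr (real DIM('a \<times> real) / 2) = 2"
      using t unfolding mult.assoc powr_add[symmetric] minus_divide_left[symmetric] add.left_inverse
      by simp
    then show ?thesis by (simp only: ennreal_mult[symmetric] powr_ge_zero mult_nonneg_nonneg zero_le_numeral)
  qed
  finally show ?thesis .
qed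

lemma continuous_on_neumann_kernel:
  fixes f g :: "'p::topological_space \<Rightarrow> 'a::euclidean_space \<times> real"
  assumes "continuous_on UNIV f" "continuous_on UNIV g"
  shows "continuous_on UNIV (\<lambda>z. neumann_kernel (f z) (g z) t)"
  unfolding neumann_kernel_def reflect_def divide_inverse
  by (intro continuous_intros assms)

section \<open>The three boundary and half-space estimates\<close>

theorem lemma4p3:
  fixes n :: nat and d1 d2 :: real
  assumes "n = DIM('a::euclidean_space \<times> real)" and "n \<ge> 3"
    and "1 < d1" and "d1 < d2"
  shows "\<exists>C::real. C > 0 \<and>
    (\<forall>\<psi>::'a \<Rightarrow> real. \<psi> \<in> lorentz1_space lebesgue d1 \<longrightarrow>
       (\<integral>\<^sup>+t\<in>{0<..}. ennreal (t powr (((real n - 1) / (2 * d1) - (real n - 1) / (2 * d2)) - 1 / 2)) *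
            lorentz1_norm lebesgue d2 (\<lambda>x'. G1 \<psi> (x', 0) t) \<partial>lborel)
         \<le> ennreal C * lorentz1_norm lebesgue d1 \<psi> \<and>
       (\<integral>\<^sup>+t\<in>{0<..}. ennreal (t powr (((real n - 1) / (2 * d1) - real n / (2 * d2)) - 1 / 2)) *
            lorentz1_norm (lebesgue_on half_space) d2 (\<lambda>x. G1 \<psi> x t) \<partial>lborel)
         \<le> ennreal C * lorentz1_norm lebesgue d1 \<psi>) \<and>
    (\<forall>\<phi>::'a \<times> real \<Rightarrow> real. \<phi> \<in> lorentz1_space (lebesgue_on half_space) d1 \<longrightarrow>
       (\<integral>\<^sup>+t\<in>{0<..}. ennreal (t powr ((real n / (2 * d1) - (real n - 1) / (2 * d2)) - 1)) *
            lorentz1_norm lebesgue d2 (\<lambda>y'. G2 \<phi> y' t) \<partial>lborel)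
         \<le> ennreal C * lorentz1_norm (lebesgue_on half_space) d1 \<phi>)"
proof -
  note d = \<open>1 < d1\<close> \<open>d1 < d2\<close>
  let ?e = "real n / 2"
  have le: "neumann_kernel x (y, 0) t \<le> 2 * t powr - ?e" if "t > 0" for x :: "'a \<times> real" and y t
    using neumann_kernel_le[OF that, of x y] assms(1) by simp
  \<comment> \<open>Between boundary points the kernel is symmetric, so the row bound serves as
    column bound.\<close>
  have sym: "neumann_kernel (x, 0) (y, 0) t = neumann_kernel (y, 0) (x, 0) t" for x y :: 'a and t
    by (simp add: neumann_kernel_boundary norm_minus_commute)
  \<comment> \<open>The factor \<open>t powr - 0\<close>, equal to 1 for \<open>t > 0\<close>, gives
    the bound the shape \<open>c * t powr - a\<close> with exponent 0.\<close>
  have half: "(\<integral>\<^sup>+x. ennreal (neumann_kernel x (y, 0) t) \<partial>lebesgue_on half_space) \<le> ennreal (2 * t powr - 0)"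
    if "t > 0" for y :: 'a and t
    using nn_integral_neumann_kernel_half_space[OF that, of y] that by simp
  note sf = sigma_finite_lebesgue sigma_finite_half_space
  note meas = borel_measurable_pair_continuous measurable_ident_lebesgue measurable_ident_half_space
    continuous_on_neumann_kernel continuous_intros
  \<comment> \<open>The left sides keep the unsimplified shape of the general estimate, with zeros
    written out, so that unification reads off \<open>a\<close>, \<open>b\<close> and
    \<open>e\<close>.\<close>
  have w: "(?e - 1/2) / d1 - (?e - 1/2) / d2 + 1/2 - 1 = ((real n - 1) / (2 * d1) - (real n - 1) / (2 * d2)) - 1 / 2"
    "(?e - 1/2) / d1 - (?e - 0) / d2 + 1/2 - 1 = ((real n - 1) / (2 * d1) - real n / (2 * d2)) - 1 / 2"
    "(?e - 0) / d1 - (?e - 1/2) / d2 + 0 - 1 = (real n / (2 * d1) - (real n - 1) / (2 * d2)) - 1"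
    using d by (simp_all add: field_simps)
  have "\<exists>C>0. \<forall>\<psi>\<in>borel_measurable lebesgue.
    (\<integral>\<^sup>+t\<in>{0<..}. ennreal (t powr ((?e - 1/2) / d1 - (?e - 1/2) / d2 + 1/2 - 1)) *
       lorentz1_norm lebesgue d2 (\<lambda>x'::'a. LINT y'|lebesgue. neumann_kernel (x', 0) (y', 0) t * \<psi> y') \<partial>lborel)
    \<le> ennreal C * lorentz1_norm lebesgue d1 \<psi>"
    using assms
    by (intro lorentz1_kernel_estimate[where c = 2] sf le neumann_kernel_nonneg nn_integral_neumann_kernel_boundary d)
      (auto simp: case_prod_beta sym[of _ y for y] intro!: meas nn_integral_neumann_kernel_boundary)
  then obtain C1 where C1: "C1 > 0" "\<And>\<psi>::'a \<Rightarrow> real. \<psi> \<in> borel_measurable lebesgue \<Longrightarrow>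
      (\<integral>\<^sup>+t\<in>{0<..}. ennreal (t powr (((real n - 1) / (2 * d1) - (real n - 1) / (2 * d2)) - 1 / 2)) *
            lorentz1_norm lebesgue d2 (\<lambda>x'. G1 \<psi> (x', 0) t) \<partial>lborel)
         \<le> ennreal C1 * lorentz1_norm lebesgue d1 \<psi>"
    unfolding w G1_def by blast
  have "\<exists>C>0. \<forall>\<psi>\<in>borel_measurable lebesgue.
    (\<integral>\<^sup>+t\<in>{0<..}. ennreal (t powr ((?e - 1/2) / d1 - (?e - 0) / d2 + 1/2 - 1)) *
       lorentz1_norm (lebesgue_on half_space) d2 (\<lambda>x::'a \<times> real. LINT y'|lebesgue. neumann_kernel x (y', 0) t * \<psi> y') \<partial>lborel)
    \<le> ennreal C * lorentz1_norm lebesgue d1 \<psi>"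
    using assms
    by (intro lorentz1_kernel_estimate[where c = 2] sf le neumann_kernel_nonneg nn_integral_neumann_kernel_boundary half d)
      (auto simp: case_prod_beta intro!: meas)
  then obtain C2 where C2: "C2 > 0" "\<And>\<psi>::'a \<Rightarrow> real. \<psi> \<in> borel_measurable lebesgue \<Longrightarrow>
       (\<integral>\<^sup>+t\<in>{0<..}. ennreal (t powr (((real n - 1) / (2 * d1) - real n / (2 * d2)) - 1 / 2)) *
            lorentz1_norm (lebesgue_on half_space) d2 (\<lambda>x. G1 \<psi> x t) \<partial>lborel)
         \<le> ennreal C2 * lorentz1_norm lebesgue d1 \<psi>"
    unfolding w G1_def by blast
  \<comment> \<open>Compared with the preceding case rows and columns trade places: integration over
    the half-space is now a row integral.\<close>
  have "\<exists>C>0. \<forall>\<phi>\<in>borel_measurable (lebesgue_on half_space).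
    (\<integral>\<^sup>+t\<in>{0<..}. ennreal (t powr ((?e - 0) / d1 - (?e - 1/2) / d2 + 0 - 1)) *
       lorentz1_norm lebesgue d2 (\<lambda>y'::'a. LINT x|lebesgue_on half_space. neumann_kernel x (y', 0) t * \<phi> x) \<partial>lborel)
    \<le> ennreal C * lorentz1_norm (lebesgue_on half_space) d1 \<phi>"
    using assms
    by (intro lorentz1_kernel_estimate[where c = 2] sf le neumann_kernel_nonneg nn_integral_neumann_kernel_boundary half d)
      (auto simp: case_prod_beta intro!: meas)
  then obtain C3 where C3: "C3 > 0" "\<And>\<phi>::'a \<times> real \<Rightarrow> real. \<phi> \<in> borel_measurable (lebesgue_on half_space) \<Longrightarrow>
       (\<integral>\<^sup>+t\<in>{0<..}. ennreal (t powr ((real n / (2 * d1) - (real n - 1) / (2 * d2)) - 1)) *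
            lorentz1_norm lebesgue d2 (\<lambda>y'. G2 \<phi> y' t) \<partial>lborel)
         \<le> ennreal C3 * lorentz1_norm (lebesgue_on half_space) d1 \<phi>"
    unfolding w G2_def by blast
  define C where "C = max C1 (max C2 C3)"
  have C: "ennreal C1 * z \<le> ennreal C * z" "ennreal C2 * z \<le> ennreal C * z" "ennreal C3 * z \<le> ennreal C * z" for z
    by (auto simp: C_def intro!: mult_right_mono ennreal_leI)
  have "C > 0" using C1 by (auto simp: C_def)
  then show ?thesis
    unfolding lorentz1_space_def
    by (intro exI[of _ C] conjI allI impI)
      (auto intro: order_trans[OF C1(2) C(1)] order_trans[OF C2(2) C(2)] order_trans[OF C3(2) C(3)])
qed

end
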